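(* Let $\Delta$ be a simplicial complex on the vertex set $[n]=\{1,\ldots,n\}$ and let $d_2,\ldots,d_n\ge 2$ be integers. Then there exists a constant $m = m(\Delta; d_2,\ldots,d_n)$, depending only on $\Delta$ and $d_2,\ldots,d_n$, such that for all integers $d_1\ge m$ (with $d_1\geq 2$), writing $d=(d_1,d_2,\ldots,d_n)$, the universal Markov basis $\mathcal{M}_{\Delta,d}$ consists of tables of format $r\times d_2\times\cdots\times d_n$ with $r\le m$; that is, for every $\mathbf{v}=(v_{i_1,\ldots,i_n})\in\mathcal{M}_{\Delta,d}$, the number $r$ of indices $i_1\in[d_1]$ for which the slice $(v_{i_1,i_2,\ldots,i_n})_{(i_2,\ldots,i_n)\in[d_2]\times\cdots\times[d_n]}$ is not identically zero satisfies $r\le m$.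
   Context: $[k]=\{1,\ldots,k\}$ and $\mathbb{N}=\{0,1,2,\ldots\}$. Let $F_1,\ldots,F_s$ be the facets (maximal faces) of $\Delta$, and let $d=(d_1,\ldots,d_n)$ with all $d_i\ge 2$ integers. Put $D=\prod_{i=1}^n d_i$ and $D_k=\prod_{j\in F_k}d_j$. The pair $(\Delta,d)$ defines a hierarchical model, with marginal map $$\pi_\Delta:\mathbb{N}^D\to\bigoplus_{k=1}^s\mathbb{N}^{D_k},\qquad (u_{i_1,\ldots,i_n}: i_j\in[d_j])\mapsto\bigoplus_{k=1}^s\ \sum_{(i_j:\,j\notin F_k)}u_{i_1,\ldots,i_n},$$ i.e. the $k$-th component is the array indexed by $\prod_{j\in F_k}[d_j]$ obtained by summing $u$ over all indices $i_j$ with $j\notin F_k$. Let $A_\Delta$ be the 0/1 matrix of this linear map, so $\ker_{\mathbb{Z}}(A_\Delta)$ is the set of integer $d_1\times\cdots\times d_n$ tables all of whose $F_k$-margins vanish. For a matrix $A$ with nonnegative integer entries, $N$ columns and no zero column, a finite set $\mathcal{M}\subset\ker_{\mathbb{Z}}(A)$ is a Markov basis of $A$ if for any $\mathbf{t},\mathbf{u}\in\mathbb{N}^N$ with $A\mathbf{t}=A\mathbf{u}$ there is a finite sequence $\mathbf{v}_1,\ldots,\mathbf{v}_s$ of elements of $\mathcal{M}$ with $\mathbf{t}+\sum_{i=1}^p\mathbf{v}_i\ge 0$ (coordinatewise) for all $1\le p\le s$ and $\mathbf{t}+\sum_{i=1}^s\mathbf{v}_i=\mathbf{u}$. A Markov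 basis is minimal if no proper subset of it is a Markov basis of $A$. The universal Markov basis $\mathcal{M}(A)$ is the union of all minimal Markov bases of $A$, and $\mathcal{M}_{\Delta,d}:=\mathcal{M}(A_\Delta)$. *)

theory Defs
  imports Main "HOL-Library.FuncSet"
begin

section \<open>Markov bases of nonnegative integer matrices\<close>

text \<open>
  A matrix is given by a finite set R of row indices, a finite set C of column indices and its
  entries. A vector with coordinates in C is a function that vanishes outside C.
\<close>

definition vecs :: "'c set \<Rightarrow> ('c \<Rightarrow> 'a::zero) set" where
  "vecs C = {v. \<forall>c. c \<notin> C \<longrightarrow> v c = 0}"

definition mat_vec :: "'c set \<Rightarrow> ('r \<Rightarrow> 'c \<Rightarrow> nat) \<Rightarrow> ('c \<Rightarrow> 'a::semiring_1) \<Rightarrow> 'r \<Rightarrow> 'a" where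
  "mat_vec C A v r = (\<Sum>c\<in>C. of_nat (A r c) * v c)"

definition int_kernel :: "'r set \<Rightarrow> 'c set \<Rightarrow> ('r \<Rightarrow> 'c \<Rightarrow> nat) \<Rightarrow> ('c \<Rightarrow> int) set" where
  "int_kernel R C A = {v \<in> vecs C. \<forall>r\<in>R. mat_vec C A v r = 0}"

definition markov_basis ::
    "'r set \<Rightarrow> 'c set \<Rightarrow> ('r \<Rightarrow> 'c \<Rightarrow> nat) \<Rightarrow> ('c \<Rightarrow> int) set \<Rightarrow> bool" where
  "markov_basis R C A M \<longleftrightarrow>
     finite M \<and> M \<subseteq> int_kernel R C A \<and>
     (\<forall>t u :: 'c \<Rightarrow> nat. t \<in> vecs C \<longrightarrow> u \<in> vecs C \<longrightarrow>
        (\<forall>r\<in>R. mat_vec C A t r = mat_vec C A u r) \<longrightarrow>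
        (\<exists>vs. set vs \<subseteq> M \<and>
              (\<forall>p\<in>{1..length vs}. \<forall>c\<in>C. int (t c) + (\<Sum>i<p. (vs ! i) c) \<ge> 0) \<and>
              (\<forall>c\<in>C. int (t c) + (\<Sum>i<length vs. (vs ! i) c) = int (u c))))"

definition minimal_markov_basis ::
    "'r set \<Rightarrow> 'c set \<Rightarrow> ('r \<Rightarrow> 'c \<Rightarrow> nat) \<Rightarrow> ('c \<Rightarrow> int) set \<Rightarrow> bool" where
  "minimal_markov_basis R C A M \<longleftrightarrow>
     markov_basis R C A M \<and> (\<forall>M'. M' \<subset> M \<longrightarrow> \<not> markov_basis R C A M')"

definition universal_markov_basis ::
    "'r set \<Rightarrow> 'c set \<Rightarrow> ('r \<Rightarrow> 'c \<Rightarrow> nat) \<Rightarrow> ('c \<Rightarrow> int) set" where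
  "universal_markov_basis R C A = \<Union> {M. minimal_markov_basis R C A M}"


section \<open>Hierarchical models\<close>

text \<open>
  Not every element of V has to be a vertex of the complex, but the void complex (no faces at all,
  not even the empty one) is excluded: it has no facets, so its matrix would have no rows and hence
  only zero columns.
\<close>

definition simplicial_complex_on :: "'v set \<Rightarrow> 'v set set \<Rightarrow> bool" where
  "simplicial_complex_on V \<Delta> \<longleftrightarrow>
     \<Delta> \<subseteq> Pow V \<and> {} \<in> \<Delta> \<and> (\<forall>F\<in>\<Delta>. \<forall>G. G \<subseteq> F \<longrightarrow> G \<in> \<Delta>)"

definition facets :: "'v set set \<Rightarrow> 'v set set" where
  "facets \<Delta> = {F \<in> \<Delta>. \<forall>G\<in>\<Delta>. F \<subseteq> G \<longrightarrow> G = F}"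

text \<open>
  A multi-index over F is extensional (undefined outside F), so that restricting a full multi-index
  to F gives an element of the index set of the F-margin.
\<close>

definition cells :: "nat set \<Rightarrow> (nat \<Rightarrow> nat) \<Rightarrow> (nat \<Rightarrow> nat) set" where
  "cells F d = (\<Pi>\<^sub>E j\<in>F. {1..d j})"

text \<open>
  The pair (F, k) indexes the entry k of the F-margin in the direct sum over all facets.
\<close>

definition margin_index :: "nat set set \<Rightarrow> (nat \<Rightarrow> nat) \<Rightarrow> (nat set \<times> (nat \<Rightarrow> nat)) set" where
  "margin_index \<Delta> d = (SIGMA F : facets \<Delta>. cells F d)"

definition marginal_map ::
    "nat \<Rightarrow> (nat \<Rightarrow> nat) \<Rightarrow> ((nat \<Rightarrow> nat) \<Rightarrow> 'a::comm_monoid_add) \<Rightarrow>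
     nat set \<times> (nat \<Rightarrow> nat) \<Rightarrow> 'a" where
  "marginal_map n d u = (\<lambda>(F, k). \<Sum>i\<in>{i \<in> cells {1..n} d. restrict i F = k}. u i)"

definition model_matrix ::
    "nat \<Rightarrow> (nat \<Rightarrow> nat) \<Rightarrow> nat set \<times> (nat \<Rightarrow> nat) \<Rightarrow> (nat \<Rightarrow> nat) \<Rightarrow> nat" where
  "model_matrix n d r i = marginal_map n d (\<lambda>i'. if i' = i then 1 else 0) r"

lemma finite_cells: "finite F \<Longrightarrow> finite (cells F d)"
  by (simp add: cells_def finite_PiE)

lemma model_matrix_entry:
  assumes "i \<in> cells {1..n} d"
  shows "model_matrix n d (F, k) i = (if restrict i F = k then 1 else 0)"
  using assms by (simp add: model_matrix_def marginal_map_def finite_cells)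

lemma mat_vec_model_matrix:
  "mat_vec (cells {1..n} d) (model_matrix n d) u r = marginal_map n d u r"
proof (cases r)
  case (Pair F k)
  have "mat_vec (cells {1..n} d) (model_matrix n d) u r =
        (\<Sum>i\<in>cells {1..n} d. if restrict i F = k then u i else 0)"
    unfolding mat_vec_def Pair by (rule sum.cong) (auto simp: model_matrix_entry)
  also have "\<dots> = marginal_map n d u r"
    by (simp add: marginal_map_def Pair sum.If_cases finite_cells Int_def)
  finally show ?thesis .
qed

definition hierarchical_umb ::
    "nat \<Rightarrow> nat set set \<Rightarrow> (nat \<Rightarrow> nat) \<Rightarrow> ((nat \<Rightarrow> nat) \<Rightarrow> int) set" where
  "hierarchical_umb n \<Delta> d =
     universal_markov_basis (margin_index \<Delta> d) (cells {1..n} d) (model_matrix n d)"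

definition nonzero_slices ::
    "nat \<Rightarrow> (nat \<Rightarrow> nat) \<Rightarrow> ((nat \<Rightarrow> nat) \<Rightarrow> int) \<Rightarrow> nat set" where
  "nonzero_slices n d v = {a \<in> {1..d 1}. \<exists>i\<in>cells {1..n} d. i 1 = a \<and> v i \<noteq> 0}"

end

theory Submission
  imports Defs Complex_Main
begin

text \<open>
  An element v of a minimal Markov basis is conformally indecomposable: if v is the sum of nonzero
  kernel elements a and b without sign cancellation, then the fibres of the negative parts of a and
  b are too small for v to be applicable in them, so v can be replaced by paths avoiding it. Every
  table with vanishing margins is a family of slices in a fixed lattice K (from the facets
  containing 1) whose sum lies in a fixed lattice L (from the other facets). By Dickson's lemma,
  each slice is a conformal sum of elements of a finite set G, and a second application of Dickson's
  lemma, to the multiplicity vectors over G with total sum in L, splits off a proper part from any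
  family with too many nonzero slices.
\<close>

section \<open>Dickson's lemma\<close>

text \<open>Every sequence has a monotone subsequence. A decreasing one in the naturals attains its
  least value at some index \<open>N\<close> and is constant from there on, so dropping the terms
  before \<open>N\<close> makes it increasing.\<close>

lemma nat_seq_mono_subseq:
  fixes s :: "nat \<Rightarrow> nat"
  shows "\<exists>r :: nat \<Rightarrow> nat. strict_mono r \<and> mono (\<lambda>k. s (r k))"
proof -
  obtain f where f: "strict_mono f" "monoseq (\<lambda>n. s (f n))"
    using seq_monosub[of s] by auto
  show ?thesis
  proof (cases "\<forall>m n. m \<le> n \<longrightarrow> s (f m) \<le> s (f n)")
    case True
    then show ?thesis using f(1) by (intro exI[of _ f]) (simp add: mono_def)
  next
    case False
    then have dec: "s (f n) \<le> s (f m)" if "m \<le> n" for m n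
      using f that by (auto simp: monoseq_def)
    obtain N where N: "\<And>k. s (f N) \<le> s (f k)"
      using ex_has_least_nat[of "\<lambda>_. True" _ "\<lambda>k. s (f k)"] by auto
    have "strict_mono (\<lambda>k. f (N + k))"
      using f by (auto simp: strict_mono_def)
    moreover have "mono (\<lambda>k. s (f (N + k)))"
      by (rule monoI) (meson N dec le_add1 le_trans)
    ultimately show ?thesis by blast
  qed
qed

text \<open>The coordinates are treated one at a time: thinning the sequence further for a new
  coordinate preserves monotonicity in the earlier ones.\<close>

lemma dickson_subseq:
  fixes f :: "nat \<Rightarrow> 'a \<Rightarrow> nat"
  assumes "finite X"
  shows "\<exists>r :: nat \<Rightarrow> nat. strict_mono r \<and> (\<forall>x\<in>X. mono (\<lambda>k. f (r k) x))"
  using assms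
proof (induction X)
  case empty
  then show ?case by (intro exI[of _ "\<lambda>k. k"]) (simp add: strict_mono_def)
next
  case (insert x X)
  then obtain r :: "nat \<Rightarrow> nat" where r: "strict_mono r" "\<forall>x\<in>X. mono (\<lambda>k. f (r k) x)" by blast
  obtain q :: "nat \<Rightarrow> nat" where q: "strict_mono q" "mono (\<lambda>k. f (r (q k)) x)"
    using nat_seq_mono_subseq[of "\<lambda>k. f (r k) x"] by blast
  have "strict_mono (\<lambda>k. r (q k))"
    using r q by (auto simp: strict_mono_def)
  moreover have "mono (\<lambda>k. f (r (q k)) z)" if "z \<in> X" for z
    using r(2) that q(1) by (auto simp: mono_def dest!: strict_mono_mono)
  ultimately show ?case using q(2) by (intro exI[of _ "\<lambda>k. r (q k)"] conjI ballI) auto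
qed

text \<open>If no finite \<open>B\<close> worked, a greedy choice would yield an infinite sequence
  in \<open>S\<close> with no term dominating an earlier one, against \<open>dickson_subseq\<close>.
  The map \<open>\<phi>\<close> allows applications to objects that are only encoded by vectors of
  naturals.\<close>

lemma dickson_finite_basis:
  fixes \<phi> :: "'b \<Rightarrow> 'a \<Rightarrow> nat"
  assumes "finite X"
  shows "\<exists>B. finite B \<and> B \<subseteq> S \<and> (\<forall>s\<in>S. \<exists>b\<in>B. \<forall>x\<in>X. \<phi> b x \<le> \<phi> s x)"
proof (rule ccontr)
  assume "\<not> ?thesis"
  then have "\<forall>B. \<exists>s. finite B \<and> B \<subseteq> S \<longrightarrow> s \<in> S \<and> (\<forall>b\<in>B. \<not> (\<forall>x\<in>X. \<phi> b x \<le> \<phi> s x))"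
    by metis
  then obtain c where c: "\<And>B. finite B \<Longrightarrow> B \<subseteq> S \<Longrightarrow>
      c B \<in> S \<and> (\<forall>b\<in>B. \<not> (\<forall>x\<in>X. \<phi> b x \<le> \<phi> (c B) x))"
    by metis
  define Bs where "Bs = rec_nat {} (\<lambda>_ B. insert (c B) B)"
  have Bs_Suc: "Bs (Suc n) = insert (c (Bs n)) (Bs n)" for n by (simp add: Bs_def)
  have Bs: "finite (Bs n) \<and> Bs n \<subseteq> S" for n
    by (induction n) (use c in \<open>auto simp: Bs_def\<close>)
  have mem: "i < j \<Longrightarrow> c (Bs i) \<in> Bs j" for i j
    by (induction j) (auto simp: Bs_Suc less_Suc_eq)
  obtain r :: "nat \<Rightarrow> nat" where r: "strict_mono r" "\<forall>x\<in>X. mono (\<lambda>k. \<phi> (c (Bs (r k))) x)"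
    using dickson_subseq[OF assms, of "\<lambda>k. \<phi> (c (Bs k))"] by blast
  have "r 0 < r 1" using r(1) by (simp add: strict_mono_def)
  moreover have "\<forall>x\<in>X. \<phi> (c (Bs (r 0))) x \<le> \<phi> (c (Bs (r 1))) x"
    using r(2) by (auto simp: mono_def)
  ultimately show False using mem c Bs by blast
qed

section \<open>Conformal decompositions\<close>

text \<open>Equivalently, \<open>a\<close> and \<open>b - a\<close> never have opposite signs, so
  that \<open>b = a + (b - a)\<close> is a sum without cancellation.\<close>

definition conformal :: "('c \<Rightarrow> int) \<Rightarrow> ('c \<Rightarrow> int) \<Rightarrow> bool" where
  "conformal a b \<longleftrightarrow> (\<forall>c. 0 \<le> a c \<and> a c \<le> b c \<or> b c \<le> a c \<and> a c \<le> 0)"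

lemma conformal_trans: "conformal a b \<Longrightarrow> conformal b c \<Longrightarrow> conformal a c"
  unfolding conformal_def by (smt (verit))

lemma conformal_diff: "conformal a b \<Longrightarrow> conformal (\<lambda>c. b c - a c) b"
  unfolding conformal_def by (smt (verit))

text \<open>At each coordinate all generators with positive multiplicity have the sign of
  \<open>w\<close>, so lowering multiplicities can only move the sum towards 0.\<close>

lemma conformal_sum_scaled:
  fixes c c' :: "('j \<Rightarrow> int) \<Rightarrow> nat"
  assumes G: "finite G" "\<And>g. g \<in> G \<Longrightarrow> c g > 0 \<Longrightarrow> conformal g w"
    and w: "w = (\<lambda>y. \<Sum>g\<in>G. int (c g) * g y)"
    and le: "\<And>g. g \<in> G \<Longrightarrow> c' g \<le> c g"
  shows "conformal (\<lambda>y. \<Sum>g\<in>G. int (c' g) * g y) w"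
  unfolding conformal_def
proof
  fix y
  show "0 \<le> (\<Sum>g\<in>G. int (c' g) * g y) \<and> (\<Sum>g\<in>G. int (c' g) * g y) \<le> w y \<or>
      w y \<le> (\<Sum>g\<in>G. int (c' g) * g y) \<and> (\<Sum>g\<in>G. int (c' g) * g y) \<le> 0"
  proof (cases "w y \<ge> 0")
    case True
    have nn: "g y \<ge> 0" if "g \<in> G" "c g > 0" for g
      using G(2)[OF that] True by (auto simp: conformal_def dest!: spec[of _ y])
    have pw: "0 \<le> int (c' g) * g y \<and> int (c' g) * g y \<le> int (c g) * g y" if "g \<in> G" for g
      using nn[OF that] le[OF that] by (cases "c g = 0") (auto intro: mult_right_mono)
    show ?thesis
      using pw unfolding w by (intro disjI1 conjI sum_nonneg sum_mono) auto
  next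
    case False
    have nn: "g y \<le> 0" if "g \<in> G" "c g > 0" for g
      using G(2)[OF that] False by (auto simp: conformal_def dest!: spec[of _ y])
    have pw: "int (c' g) * g y \<le> 0 \<and> int (c g) * g y \<le> int (c' g) * g y" if "g \<in> G" for g
      using nn[OF that] le[OF that]
      by (cases "c g = 0") (auto intro: mult_right_mono_neg mult_nonneg_nonpos)
    show ?thesis
      using pw unfolding w by (intro disjI2 conjI sum_nonpos sum_mono) auto
  qed
qed

text \<open>After multiplication by \<open>sgn (w y)\<close> all summands are nonnegative, so a
  vanishing sum kills each of them, and a nonzero generator is seen at some \<open>y\<close>. This
  serves to show that a split is neither zero nor everything.\<close>

lemma conformal_sum_scaled_eq_0:
  fixes c c' :: "('j \<Rightarrow> int) \<Rightarrow> nat"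
  assumes G: "finite G" "\<And>g. g \<in> G \<Longrightarrow> c g > 0 \<Longrightarrow> conformal g w"
    and nz: "\<And>g. g \<in> G \<Longrightarrow> \<exists>y. g y \<noteq> 0"
    and le: "\<And>g. g \<in> G \<Longrightarrow> c' g \<le> c g"
    and 0: "\<And>y. (\<Sum>g\<in>G. int (c' g) * g y) = 0"
    and g: "g \<in> G"
  shows "c' g = 0"
proof (rule ccontr)
  assume "c' g \<noteq> 0"
  have same: "int (c' g') * g' y * sgn (w y) \<ge> 0" if "g' \<in> G" for g' y
  proof (cases "c g' = 0")
    case True
    then show ?thesis using le[OF that] by simp
  next
    case False
    then have "g' y * sgn (w y) \<ge> 0"
      using G(2)[OF that] by (auto simp: conformal_def sgn_if dest!: spec[of _ y])
    then show ?thesis by (simp add: mult.assoc)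
  qed
  obtain y where y: "g y \<noteq> 0" using nz g by blast
  have "(\<Sum>g'\<in>G. int (c' g') * g' y * sgn (w y)) = 0"
    using 0[of y] by (simp flip: sum_distrib_right)
  then have "int (c' g) * g y * sgn (w y) = 0"
    using sum_nonneg_eq_0_iff[of G "\<lambda>g'. int (c' g') * g' y * sgn (w y)"] G(1) same g by blast
  moreover have "w y \<noteq> 0"
    using G(2)[OF g] y \<open>c' g \<noteq> 0\<close> le[OF g] by (auto simp: conformal_def dest!: spec[of _ y])
  ultimately show False using y \<open>c' g \<noteq> 0\<close> by (auto simp: sgn_if split: if_splits)
qed

section \<open>Subgroups of integer vectors and their conformal generators\<close>

definition lattice_on :: "'j set \<Rightarrow> ('j \<Rightarrow> int) set \<Rightarrow> bool" where
  "lattice_on J K \<longleftrightarrow> K \<subseteq> vecs J \<and> (\<lambda>_. 0) \<in> K \<and>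
     (\<forall>x\<in>K. \<forall>y\<in>K. (\<lambda>j. x j - y j) \<in> K)"

lemma lattice_on_diff:
  "lattice_on J K \<Longrightarrow> x \<in> K \<Longrightarrow> y \<in> K \<Longrightarrow> (\<lambda>j. x j - y j) \<in> K"
  by (auto simp: lattice_on_def)

lemma lattice_on_add:
  assumes "lattice_on J K" "x \<in> K" "y \<in> K"
  shows "(\<lambda>j. x j + y j) \<in> K"
proof -
  have "(\<lambda>_. 0) \<in> K" using assms(1) by (simp add: lattice_on_def)
  then have "(\<lambda>j. 0 - y j) \<in> K" using lattice_on_diff[OF assms(1) _ assms(3)] by blast
  from lattice_on_diff[OF assms(1,2) this] show ?thesis by simp
qed

lemma lattice_on_scale:
  assumes "lattice_on J K" "x \<in> K"
  shows "(\<lambda>j. int m * x j) \<in> K"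
proof (induction m)
  case 0
  then show ?case using assms by (simp add: lattice_on_def)
next
  case (Suc m)
  then show ?case using lattice_on_add[OF assms(1) assms(2) Suc] by (simp add: algebra_simps)
qed

lemma lattice_on_sum:
  assumes "lattice_on J K" "finite T" "\<And>t. t \<in> T \<Longrightarrow> x t \<in> K"
  shows "(\<lambda>j. \<Sum>t\<in>T. x t j) \<in> K"
  using assms(2,3)
proof (induction T)
  case empty
  then show ?case using assms by (simp add: lattice_on_def)
next
  case (insert t T)
  then show ?case using lattice_on_add[OF assms(1), of "x t" "\<lambda>j. \<Sum>t\<in>T. x t j"] by simp
qed

text \<open>This is the finiteness of the Graver basis: \<open>G\<close> must contain every
  conformally minimal nonzero element of \<open>K\<close>.\<close>

lemma finite_conformal_basis:
  assumes J: "finite J" and K: "lattice_on J K"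
  shows "\<exists>G. finite G \<and> G \<subseteq> K - {\<lambda>_. 0} \<and> (\<forall>w\<in>K - {\<lambda>_. 0}. \<exists>g\<in>G. conformal g w)"
proof -
  \<comment> \<open>The encoding lists positive and negative parts separately; domination of these
    on \<open>J\<close> is the conformal order.\<close>
  define \<phi> where "\<phi> w = (\<lambda>(y, s). if s then nat (w y) else nat (- w y))" for w :: "'a \<Rightarrow> int"
  obtain G where G: "finite G" "G \<subseteq> K - {\<lambda>_. 0}"
    "\<forall>s\<in>K - {\<lambda>_. 0}. \<exists>b\<in>G. \<forall>x\<in>J \<times> UNIV. \<phi> b x \<le> \<phi> s x"
    using dickson_finite_basis[of "J \<times> (UNIV :: bool set)" "K - {\<lambda>_. 0}" \<phi>] J by auto
  have "conformal g w"
    if "g \<in> K" "w \<in> K" and le: "\<forall>x\<in>J \<times> UNIV. \<phi> g x \<le> \<phi> w x" for g w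
    unfolding conformal_def
  proof
    fix y
    show "0 \<le> g y \<and> g y \<le> w y \<or> w y \<le> g y \<and> g y \<le> 0"
    proof (cases "y \<in> J")
      case True
      then show ?thesis
        using bspec[OF le, of "(y, True)"] bspec[OF le, of "(y, False)"]
        by (auto simp: \<phi>_def)
    next
      case False
      then have "g y = 0" "w y = 0" using that K by (auto simp: lattice_on_def vecs_def)
      then show ?thesis by simp
    qed
  qed
  then show ?thesis using G by (meson DiffD1 subsetD)
qed

text \<open>Induction on the l1 norm: subtracting a conformal generator causes no cancellation, so
  the norm drops by the positive norm of the generator and the remainder stays conformal to
  \<open>w\<close>.\<close>

lemma conformal_decomposition:
  assumes J: "finite J" and K: "lattice_on J K"
    and G: "finite G" "G \<subseteq> K - {\<lambda>_. 0}" "\<forall>w\<in>K - {\<lambda>_. 0}. \<exists>g\<in>G. conformal g w"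
    and w: "w \<in> K"
  shows "\<exists>c. (\<forall>g\<in>G. c g > 0 \<longrightarrow> conformal g w) \<and> w = (\<lambda>y. \<Sum>g\<in>G. int (c g) * g y)"
  using w
proof (induction "nat (\<Sum>y\<in>J. \<bar>w y\<bar>)" arbitrary: w rule: less_induct)
  case less
  show ?case
  proof (cases "w = (\<lambda>_. 0)")
    case True
    then show ?thesis by (intro exI[of _ "\<lambda>_. 0"]) simp
  next
    case False
    then obtain g where g: "g \<in> G" "conformal g w" using G less.prems by blast
    define u where "u = (\<lambda>y. w y - g y)"
    have uK: "u \<in> K" unfolding u_def using lattice_on_diff[OF K less.prems] g G by blast
    have uw: "conformal u w" unfolding u_def by (rule conformal_diff[OF g(2)])
    have abs: "\<bar>w y\<bar> = \<bar>u y\<bar> + \<bar>g y\<bar>" for y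
      using g(2) by (auto simp: conformal_def u_def dest!: spec[of _ y])
    obtain y where y: "g y \<noteq> 0" using g G by fastforce
    have "y \<in> J" using y g G K by (auto simp: lattice_on_def vecs_def)
    then have "(\<Sum>y\<in>J. \<bar>g y\<bar>) > 0" using y J by (intro sum_pos2[of _ y]) auto
    then have "nat (\<Sum>y\<in>J. \<bar>u y\<bar>) < nat (\<Sum>y\<in>J. \<bar>w y\<bar>)"
      unfolding abs sum.distrib by (simp add: sum_nonneg add_nonneg_pos)
    then obtain c where c: "\<forall>g\<in>G. c g > 0 \<longrightarrow> conformal g u"
      "u = (\<lambda>y. \<Sum>g\<in>G. int (c g) * g y)"
      using less.hyps uK by blast
    define c' where "c' = c(g := Suc (c g))"
    have "(\<Sum>h\<in>G. int (c' h) * h y) = (\<Sum>h\<in>G. int (c h) * h y) + g y" for y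
      using g(1) G(1) by (simp add: sum.remove[of G g] c'_def algebra_simps)
    then have "w = (\<lambda>y. \<Sum>h\<in>G. int (c' h) * h y)"
      using c(2) by (auto simp: u_def fun_eq_iff algebra_simps)
    moreover have "\<forall>h\<in>G. c' h > 0 \<longrightarrow> conformal h w"
      using c(1) g uw conformal_trans by (auto simp: c'_def)
    ultimately show ?thesis by blast
  qed
qed

section \<open>Splitting families with many nonzero members\<close>

text \<open>Greedy distribution: the index \<open>i\<close> takes as much of \<open>h\<close> as
  \<open>c i\<close> permits, and the rest is passed on.\<close>

lemma split_below_sum:
  fixes c :: "'i \<Rightarrow> nat"
  assumes "finite I" "h \<le> sum c I"
  shows "\<exists>c'. (\<forall>i\<in>I. c' i \<le> c i) \<and> sum c' I = h"
  using assms
proof (induction I arbitrary: h)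
  case empty
  then show ?case by auto
next
  case (insert i I)
  obtain c' where c': "\<forall>i\<in>I. c' i \<le> c i" "sum c' I = h - min h (c i)"
    using insert.IH[of "h - min h (c i)"] insert.hyps insert.prems by fastforce
  have "sum (c'(i := min h (c i))) I = sum c' I"
    using insert.hyps by (intro sum.cong) auto
  then have "sum (c'(i := min h (c i))) (insert i I) = h"
    using insert.hyps c'(2) by simp
  then show ?case using c' insert by (intro exI[of _ "c'(i := min h (c i))"]) auto
qed

text \<open>If \<open>w\<close> lists the slices of a kernel table, a witness \<open>w'\<close>
  lists those of a kernel table conformal to it; the last two conditions exclude the zero table and
  the table itself.\<close>

definition splittable ::
    "('j \<Rightarrow> int) set \<Rightarrow> ('j \<Rightarrow> int) set \<Rightarrow> 'i set \<Rightarrow> ('i \<Rightarrow> 'j \<Rightarrow> int) \<Rightarrow> bool" where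
  "splittable K L I w \<longleftrightarrow> (\<exists>w'. (\<forall>i\<in>I. w' i \<in> K \<and> conformal (w' i) (w i)) \<and>
     (\<lambda>y. \<Sum>i\<in>I. w' i y) \<in> L \<and> (\<exists>i\<in>I. w' i \<noteq> (\<lambda>_. 0)) \<and> (\<exists>i\<in>I. w' i \<noteq> w i))"

text \<open>Families over index sets of any size are compared through vectors of one fixed length,
  which count how often each generator in \<open>G\<close> occurs in the conformal decompositions of
  all members together. This makes \<open>m\<close> independent of \<open>I\<close> and
  \<open>w\<close>.\<close>

lemma bounded_conformal_complexity:
  fixes K L :: "('j \<Rightarrow> int) set"
  assumes J: "finite J" and K: "lattice_on J K" and L: "lattice_on J L"
  obtains m :: nat where "\<And>(I :: 'i set) w. finite I \<Longrightarrow> (\<And>i. i \<in> I \<Longrightarrow> w i \<in> K) \<Longrightarrow>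
    (\<lambda>y. \<Sum>i\<in>I. w i y) \<in> L \<Longrightarrow> m < card {i \<in> I. w i \<noteq> (\<lambda>_. 0)} \<Longrightarrow> splittable K L I w"
proof -
  obtain G where G: "finite G" "G \<subseteq> K - {\<lambda>_. 0}" "\<forall>w\<in>K - {\<lambda>_. 0}. \<exists>g\<in>G. conformal g w"
    using finite_conformal_basis[OF J K] by blast
  have nz: "\<exists>y. g y \<noteq> 0" if "g \<in> G" for g using that G(2) by fastforce
  \<comment> \<open>The positive entry keeps the zero vector out, which would lie below every
    multiplicity vector and yield only the trivial split.\<close>
  define S where "S = {\<psi> :: ('j \<Rightarrow> int) \<Rightarrow> nat. (\<exists>g\<in>G. \<psi> g > 0) \<and> (\<lambda>y. \<Sum>g\<in>G. int (\<psi> g) * g y) \<in> L}"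
  obtain H where H: "finite H" "H \<subseteq> S" "\<forall>\<psi>\<in>S. \<exists>h\<in>H. \<forall>g\<in>G. h g \<le> \<psi> g"
    using dickson_finite_basis[OF G(1), of S "\<lambda>\<psi>. \<psi>"] by auto
  \<comment> \<open>Any upper bound for the total multiplicities of the finitely many members of
    \<open>H\<close> would do.\<close>
  define m where "m = (\<Sum>h\<in>H. sum h G)"
  have m: "sum h G \<le> m" if "h \<in> H" for h
    unfolding m_def using H(1) that by (intro member_le_sum) auto
  show ?thesis
  proof (rule that)
    fix I :: "'i set" and w
    assume I: "finite I" and wK: "\<And>i. i \<in> I \<Longrightarrow> w i \<in> K" and wL: "(\<lambda>y. \<Sum>i\<in>I. w i y) \<in> L"
      and many: "m < card {i\<in>I. w i \<noteq> (\<lambda>_. 0)}"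
    have "\<forall>i\<in>I. \<exists>c. (\<forall>g\<in>G. c g > 0 \<longrightarrow> conformal g (w i)) \<and> w i = (\<lambda>y. \<Sum>g\<in>G. int (c g) * g y)"
      using conformal_decomposition[OF J K G wK] by blast
    then obtain c where c: "\<And>i g. i \<in> I \<Longrightarrow> g \<in> G \<Longrightarrow> c i g > 0 \<Longrightarrow> conformal g (w i)"
      "\<And>i. i \<in> I \<Longrightarrow> w i = (\<lambda>y. \<Sum>g\<in>G. int (c i g) * g y)"
      by metis
    define \<psi> where "\<psi> g = (\<Sum>i\<in>I. c i g)" for g
    have swap: "(\<Sum>i\<in>I. \<Sum>g\<in>G. int (e i g) * g y) = (\<Sum>g\<in>G. int (\<Sum>i\<in>I. e i g) * g y)"
      for e :: "'i \<Rightarrow> ('j \<Rightarrow> int) \<Rightarrow> nat" and y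
      by (subst sum.swap) (simp add: sum_distrib_right)
    have wsum: "(\<lambda>y. \<Sum>i\<in>I. w i y) = (\<lambda>y. \<Sum>g\<in>G. int (\<psi> g) * g y)"
      unfolding \<psi>_def swap[symmetric] using c(2) by (auto intro!: sum.cong ext)
    have pos: "sum (c i) G \<ge> 1" if "i \<in> I" "w i \<noteq> (\<lambda>_. 0)" for i
    proof (rule ccontr)
      assume "\<not> 1 \<le> sum (c i) G"
      then have "\<forall>g\<in>G. c i g = 0" using G(1) by (simp add: not_le)
      then have "w i = (\<lambda>_. 0)" by (subst c(2)[OF that(1)]) simp
      then show False using that by simp
    qed
    \<comment> \<open>Each nonzero member uses at least one generator, so the total multiplicity
      exceeds \<open>m\<close>.\<close>
    have "card {i\<in>I. w i \<noteq> (\<lambda>_. 0)} \<le> (\<Sum>i\<in>{i\<in>I. w i \<noteq> (\<lambda>_. 0)}. sum (c i) G)"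
      using pos sum_mono[of "{i\<in>I. w i \<noteq> (\<lambda>_. 0)}" "\<lambda>_. 1" "\<lambda>i. sum (c i) G"] by simp
    also have "\<dots> \<le> (\<Sum>i\<in>I. sum (c i) G)" using I by (intro sum_mono2) auto
    also have "\<dots> = sum \<psi> G" unfolding \<psi>_def by (rule sum.swap)
    finally have big: "m < sum \<psi> G" using many by linarith
    then have "\<exists>g\<in>G. \<psi> g > 0" by (metis gr0I less_zeroE sum.neutral)
    then have "\<psi> \<in> S" using wL wsum by (auto simp: S_def)
    then obtain h where h: "h \<in> H" "\<forall>g\<in>G. h g \<le> \<psi> g" using H by blast
    \<comment> \<open>The multiplicity \<open>h g\<close> is distributed over the members that use
      \<open>g\<close>, never exceeding their own multiplicities; this turns the small vector
      \<open>h\<close> into a conformal part of the family.\<close>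
    have "\<forall>g\<in>G. \<exists>e. (\<forall>i\<in>I. e i \<le> c i g) \<and> sum e I = h g"
      using split_below_sum[OF I] h(2) by (auto simp: \<psi>_def)
    then obtain e where e: "\<And>i g. i \<in> I \<Longrightarrow> g \<in> G \<Longrightarrow> e g i \<le> c i g" "\<And>g. g \<in> G \<Longrightarrow> sum (e g) I = h g"
      by metis
    define w' where "w' i = (\<lambda>y. \<Sum>g\<in>G. int (e g i) * g y)" for i
    have "w' i \<in> K" for i
      unfolding w'_def using G(2) by (intro lattice_on_sum[OF K G(1)] lattice_on_scale[OF K]) auto
    moreover have "conformal (w' i) (w i)" if "i \<in> I" for i
      unfolding w'_def using conformal_sum_scaled[OF G(1) c(1)[OF that] c(2)[OF that] e(1)[OF that]] .
    moreover have "(\<lambda>y. \<Sum>i\<in>I. w' i y) \<in> L"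
    proof -
      have "(\<lambda>y. \<Sum>i\<in>I. w' i y) = (\<lambda>y. \<Sum>g\<in>G. int (h g) * g y)"
        unfolding w'_def swap[of "\<lambda>i g. e g i"] using e(2) by (auto intro!: sum.cong ext)
      then show ?thesis using h(1) H(2) by (auto simp: S_def)
    qed
    moreover have "\<exists>i\<in>I. w' i \<noteq> (\<lambda>_. 0)"
    proof (rule ccontr)
      assume "\<not> ?thesis"
      then have 0: "(\<Sum>g\<in>G. int (e g i) * g y) = 0" if "i \<in> I" for i y
        using that by (auto simp: w'_def fun_eq_iff)
      have "e g i = 0" if "g \<in> G" "i \<in> I" for g i
        using conformal_sum_scaled_eq_0[OF G(1) c(1)[OF that(2)] nz e(1)[OF that(2)] 0[OF that(2)] that(1)] .
      then have "\<forall>g\<in>G. h g = 0" using e(2) by (metis sum.neutral)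
      then show False using h(1) H(2) by (auto simp: S_def)
    qed
    moreover have "\<exists>i\<in>I. w' i \<noteq> w i"
    proof (rule ccontr)
      assume "\<not> ?thesis"
      then have eq: "w' i = w i" if "i \<in> I" for i using that by blast
      \<comment> \<open>The complementary part has multiplicities \<open>c i g - e g i\<close>,
        where truncated subtraction is exact. If that part vanished, \<open>h\<close> and
        \<open>\<psi>\<close> would agree on \<open>G\<close>, although their totals are separated
        by \<open>m\<close>.\<close>
      have 0: "(\<Sum>g\<in>G. int (c i g - e g i) * g y) = 0" if "i \<in> I" for i y
      proof -
        have "(\<Sum>g\<in>G. int (c i g - e g i) * g y) = w i y - w' i y"
          using e(1)[OF that] by (subst c(2)[OF that])
            (auto simp: w'_def of_nat_diff algebra_simps simp flip: sum_subtractf intro!: sum.cong)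
        then show ?thesis using eq[OF that] by simp
      qed
      have "c i g - e g i = 0" if "g \<in> G" "i \<in> I" for g i
        using conformal_sum_scaled_eq_0[OF G(1) c(1)[OF that(2)] nz _ 0[OF that(2)] that(1)] by simp
      then have "\<psi> g = h g" if "g \<in> G" for g
        unfolding \<psi>_def e(2)[OF that, symmetric] using e(1) that
        by (intro sum.cong) (simp_all add: le_antisym)
      then have "sum \<psi> G = sum h G" by simp
      then show False using big m[OF h(1)] by simp
    qed
    ultimately show "splittable K L I w" unfolding splittable_def by blast
  qed
qed

section \<open>Indecomposability of minimal Markov basis elements\<close>

text \<open>Only the target of a step is tested for nonnegativity, as in
  \<open>markov_basis\<close>, where the partial sums start at \<open>p = 1\<close>. Reachability
  then becomes a reflexive transitive closure.\<close>

definition markov_steps :: "'c set \<Rightarrow> ('c \<Rightarrow> int) set \<Rightarrow> (('c \<Rightarrow> int) \<times> ('c \<Rightarrow> int)) set" where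
  "markov_steps C M = {(x, y). \<exists>v\<in>M. y = (\<lambda>c. x c + v c) \<and> (\<forall>c\<in>C. 0 \<le> y c)}"

lemma markov_path_imp_rtrancl:
  assumes M: "M \<subseteq> vecs C" and x: "x \<in> vecs C" and y: "y \<in> vecs C"
    and vs: "set vs \<subseteq> M" "\<forall>p\<in>{1..length vs}. \<forall>c\<in>C. x c + (\<Sum>i<p. (vs ! i) c) \<ge> 0"
    and end_eq: "\<forall>c\<in>C. x c + (\<Sum>i<length vs. (vs ! i) c) = y c"
  shows "(x, y) \<in> (markov_steps C M)\<^sup>*"
proof -
  define z where "z p = (\<lambda>c. x c + (\<Sum>i<p. (vs ! i) c))" for p
  have path: "p \<le> length vs \<Longrightarrow> (x, z p) \<in> (markov_steps C M)\<^sup>*" for p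
  proof (induction p)
    case 0
    then show ?case by (simp add: z_def)
  next
    case (Suc p)
    have "z (Suc p) = (\<lambda>c. z p c + (vs ! p) c)" by (simp add: z_def add.assoc)
    moreover have "vs ! p \<in> M" using Suc.prems vs(1) by (meson Suc_le_lessD nth_mem subsetD)
    moreover have "\<forall>c\<in>C. 0 \<le> z (Suc p) c"
      using bspec[OF vs(2), of "Suc p"] Suc.prems by (simp add: z_def)
    ultimately have "(z p, z (Suc p)) \<in> markov_steps C M" by (auto simp: markov_steps_def)
    then show ?case using Suc by (meson Suc_leD rtrancl.rtrancl_into_rtrancl)
  qed
  \<comment> \<open>Outside \<open>C\<close> all moves and both end points vanish, so agreement on
    \<open>C\<close> gives equality of functions.\<close>
  have "z (length vs) c = y c" for c
  proof (cases "c \<in> C")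
    case True
    then show ?thesis using end_eq by (simp add: z_def)
  next
    case False
    then have "(vs ! i) c = 0" if "i < length vs" for i
      using that M vs(1) by (auto simp: vecs_def dest!: nth_mem)
    then show ?thesis using False x y by (simp add: z_def vecs_def)
  qed
  then have "z (length vs) = y" by auto
  then show ?thesis using path[of "length vs"] by simp
qed

lemma rtrancl_imp_markov_path:
  assumes "(x, y) \<in> (markov_steps C M)\<^sup>*"
  shows "\<exists>vs. set vs \<subseteq> M \<and> (\<forall>p\<in>{1..length vs}. \<forall>c\<in>C. x c + (\<Sum>i<p. (vs ! i) c) \<ge> 0) \<and>
    (\<forall>c. x c + (\<Sum>i<length vs. (vs ! i) c) = y c)"
  using assms
proof (induction rule: rtrancl_induct)
  case base
  then show ?case by (intro exI[of _ "[]"]) simp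
next
  case (step y z)
  then obtain vs where vs: "set vs \<subseteq> M"
    "\<forall>p\<in>{1..length vs}. \<forall>c\<in>C. x c + (\<Sum>i<p. (vs ! i) c) \<ge> 0"
    "\<forall>c. x c + (\<Sum>i<length vs. (vs ! i) c) = y c" by blast
  obtain v where v: "v \<in> M" "z = (\<lambda>c. y c + v c)" "\<forall>c\<in>C. 0 \<le> z c"
    using step.hyps(2) by (auto simp: markov_steps_def)
  have old: "(\<Sum>i<p. ((vs @ [v]) ! i) c) = (\<Sum>i<p. (vs ! i) c)" if "p \<le> length vs" for p c
    using that by (intro sum.cong) (auto simp: nth_append)
  have new: "x c + (\<Sum>i<length (vs @ [v]). ((vs @ [v]) ! i) c) = z c" for c
    using old[of "length vs" c] vs(3) v(2) by (simp add: add.assoc[symmetric])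
  have "x c + (\<Sum>i<p. ((vs @ [v]) ! i) c) \<ge> 0" if "p \<in> {1..length (vs @ [v])}" "c \<in> C" for p c
  proof (cases "p \<le> length vs")
    case True
    then show ?thesis using old[OF True] vs(2) that by simp
  next
    case False
    then have "p = length (vs @ [v])" using that by simp
    then show ?thesis using new v(3) that(2) by metis
  qed
  then show ?case using vs(1) v(1) new by (intro exI[of _ "vs @ [v]"]) auto
qed

lemma int_mat_vec: "int (mat_vec C A t r) = mat_vec C A (\<lambda>c. int (t c)) r"
  by (simp add: mat_vec_def)

lemma mat_vec_add: "mat_vec C A (\<lambda>c. x c + y c) r = mat_vec C A x r + mat_vec C A (y :: _ \<Rightarrow> int) r"
  by (simp add: mat_vec_def sum.distrib algebra_simps)

lemma mat_vec_diff: "mat_vec C A (\<lambda>c. x c - y c) r = mat_vec C A x r - mat_vec C A (y :: _ \<Rightarrow> int) r"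
  by (simp add: mat_vec_def sum_subtractf algebra_simps)

text \<open>Passing from vectors of naturals to nonnegative integer vectors, and from lists of moves
  to reachability, allows paths to be translated, concatenated and rerouted.\<close>

lemma markov_basis_iff:
  "markov_basis R C A M \<longleftrightarrow> finite M \<and> M \<subseteq> int_kernel R C A \<and>
     (\<forall>x\<in>vecs C. \<forall>y\<in>vecs C. (\<forall>c. 0 \<le> x c) \<longrightarrow> (\<forall>c. 0 \<le> y c) \<longrightarrow>
        (\<forall>r\<in>R. mat_vec C A x r = mat_vec C A y r) \<longrightarrow> (x, y) \<in> (markov_steps C M)\<^sup>*)"
  (is "?L \<longleftrightarrow> ?F \<and> ?S \<and> ?P")
proof
  assume L: ?L
  have M: "M \<subseteq> vecs C" using L by (auto simp: markov_basis_def int_kernel_def)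
  have "(x, y) \<in> (markov_steps C M)\<^sup>*"
    if xy: "x \<in> vecs C" "y \<in> vecs C" "\<forall>c. 0 \<le> x c" "\<forall>c. 0 \<le> y c"
      "\<forall>r\<in>R. mat_vec C A x r = mat_vec C A y r" for x y
  proof -
    define t u where "t = (\<lambda>c. nat (x c))" and "u = (\<lambda>c. nat (y c))"
    have tu: "x = (\<lambda>c. int (t c))" "y = (\<lambda>c. int (u c))"
      using xy by (auto simp: t_def u_def)
    have "t \<in> vecs C" "u \<in> vecs C" using xy by (auto simp: t_def u_def vecs_def)
    moreover have "\<forall>r\<in>R. mat_vec C A t r = mat_vec C A u r"
      using xy(5) unfolding tu int_mat_vec[symmetric] by simp
    ultimately obtain vs where "set vs \<subseteq> M"
      "\<forall>p\<in>{1..length vs}. \<forall>c\<in>C. int (t c) + (\<Sum>i<p. (vs ! i) c) \<ge> 0"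
      "\<forall>c\<in>C. int (t c) + (\<Sum>i<length vs. (vs ! i) c) = int (u c)"
      using L unfolding markov_basis_def by blast
    then show ?thesis
      using markov_path_imp_rtrancl[OF M xy(1,2)] unfolding tu by blast
  qed
  then show "?F \<and> ?S \<and> ?P" using L by (auto simp: markov_basis_def)
next
  assume R: "?F \<and> ?S \<and> ?P"
  have "\<exists>vs. set vs \<subseteq> M \<and>
      (\<forall>p\<in>{1..length vs}. \<forall>c\<in>C. int (t c) + (\<Sum>i<p. (vs ! i) c) \<ge> 0) \<and>
      (\<forall>c\<in>C. int (t c) + (\<Sum>i<length vs. (vs ! i) c) = int (u c))"
    if tu: "t \<in> vecs C" "u \<in> vecs C" "\<forall>r\<in>R. mat_vec C A t r = mat_vec C A u r" for t u :: "'b \<Rightarrow> nat"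
  proof -
    have "(\<lambda>c. int (t c)) \<in> vecs C" "(\<lambda>c. int (u c)) \<in> vecs C"
      using tu by (auto simp: vecs_def)
    moreover have "\<forall>r\<in>R. mat_vec C A (\<lambda>c. int (t c)) r = mat_vec C A (\<lambda>c. int (u c)) r"
      using tu(3) by (simp flip: int_mat_vec)
    ultimately have "((\<lambda>c. int (t c)), (\<lambda>c. int (u c))) \<in> (markov_steps C M)\<^sup>*"
      using R by auto
    from rtrancl_imp_markov_path[OF this] show ?thesis by blast
  qed
  then show ?L using R unfolding markov_basis_def by blast
qed

text \<open>Translating a whole path by a nonnegative vector keeps its vertices nonnegative and its
  moves unchanged.\<close>

lemma markov_steps_rtrancl_shift:
  assumes "(x, y) \<in> (markov_steps C M)\<^sup>*" "\<forall>c\<in>C. 0 \<le> z c"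
  shows "((\<lambda>c. x c + z c), (\<lambda>c. y c + z c)) \<in> (markov_steps C M)\<^sup>*"
  using assms(1)
proof (induction rule: rtrancl_induct)
  case base
  then show ?case by simp
next
  case (step y y')
  then obtain v where "v \<in> M" "y' = (\<lambda>c. y c + v c)" "\<forall>c\<in>C. 0 \<le> y' c"
    by (auto simp: markov_steps_def)
  then have "((\<lambda>c. y c + z c), (\<lambda>c. y' c + z c)) \<in> markov_steps C M"
    using assms(2) by (auto simp: markov_steps_def intro!: bexI[of _ v] add_nonneg_nonneg simp del: fun_upd_apply)
  then show ?case by (rule rtrancl.rtrancl_into_rtrancl[OF step.IH])
qed

section \<open>Sign parts and rerouting around a decomposable move\<close>

definition pos_part :: "('c \<Rightarrow> int) \<Rightarrow> 'c \<Rightarrow> int" where "pos_part a = (\<lambda>c. max (a c) 0)"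
definition neg_part :: "('c \<Rightarrow> int) \<Rightarrow> 'c \<Rightarrow> int" where "neg_part a = (\<lambda>c. max (- a c) 0)"

lemma mat_vec_pos_neg_part:
  assumes "a \<in> int_kernel R C A" "r \<in> R"
  shows "mat_vec C A (pos_part a) r = mat_vec C A (neg_part a) r"
proof -
  have "a = (\<lambda>c. pos_part a c - neg_part a c)" by (auto simp: pos_part_def neg_part_def)
  then have "mat_vec C A a r = mat_vec C A (pos_part a) r - mat_vec C A (neg_part a) r"
    using mat_vec_diff by metis
  then show ?thesis using assms by (simp add: int_kernel_def)
qed

text \<open>A positive coordinate would make some row positive, since no column is zero and no terms
  cancel. It follows that comparable vectors in one fibre coincide on \<open>C\<close>.\<close>

lemma mat_vec_nonpos_imp_eq_0:
  fixes x :: "'c \<Rightarrow> int"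
  assumes C: "finite C" "\<forall>c\<in>C. \<exists>r\<in>R. A r c > 0"
    and x: "\<forall>c\<in>C. 0 \<le> x c" "\<forall>r\<in>R. mat_vec C A x r \<le> 0" and c: "c \<in> C"
  shows "x c = 0"
proof -
  obtain r where r: "r \<in> R" "A r c > 0" using C(2) c by blast
  have nn: "0 \<le> int (A r c) * x c" if "c \<in> C" for c using x(1) that by simp
  have "mat_vec C A x r = 0"
    using x(2) r(1) nn by (intro antisym) (auto simp: mat_vec_def intro!: sum_nonneg)
  then have "int (A r c) * x c = 0"
    using sum_nonneg_eq_0_iff[OF C(1) nn] c by (simp add: mat_vec_def)
  then show ?thesis using r(2) by simp
qed

text \<open>The move \<open>v\<close> applies only to vectors above
  \<open>neg_part a + neg_part b\<close>. The path stays in the fibre of \<open>neg_part a\<close>,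
  which contains no such vector because \<open>b\<close> is nonzero.\<close>

lemma nonneg_path_avoids_decomposable:
  assumes C: "finite C" "\<forall>c\<in>C. \<exists>r\<in>R. A r c > 0"
    and M: "markov_basis R C A M"
    and a: "a \<in> int_kernel R C A" and b: "b \<in> int_kernel R C A" "b \<noteq> (\<lambda>_. 0)"
    and v: "\<And>c. neg_part v c = neg_part a c + neg_part b c"
  shows "(neg_part a, pos_part a) \<in> (markov_steps C (M - {v}))\<^sup>*"
proof -
  have MK: "M \<subseteq> int_kernel R C A" using M by (simp add: markov_basis_def)
  have parts: "pos_part a \<in> vecs C" "neg_part a \<in> vecs C"
    using a by (auto simp: int_kernel_def vecs_def pos_part_def neg_part_def)
  have "(neg_part a, pos_part a) \<in> (markov_steps C M)\<^sup>*"
    using M parts mat_vec_pos_neg_part[OF a]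
    unfolding markov_basis_iff by (auto simp: pos_part_def neg_part_def)
  \<comment> \<open>The claim is strengthened by an invariant for the induction: every vertex is
    nonnegative and lies in the fibre of \<open>neg_part a\<close>.\<close>
  then have "(\<forall>c\<in>C. 0 \<le> pos_part a c) \<and>
      (\<forall>r\<in>R. mat_vec C A (pos_part a) r = mat_vec C A (neg_part a) r) \<and>
      (neg_part a, pos_part a) \<in> (markov_steps C (M - {v}))\<^sup>*"
  proof (induction rule: rtrancl_induct)
    case base
    then show ?case by (simp add: neg_part_def)
  next
    case (step y z)
    then obtain u where u: "u \<in> M" "z = (\<lambda>c. y c + u c)" "\<forall>c\<in>C. 0 \<le> z c"
      by (auto simp: markov_steps_def)
    have mz: "\<forall>r\<in>R. mat_vec C A z r = mat_vec C A (neg_part a) r"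
      using step.IH u(1,2) MK by (auto simp: mat_vec_add int_kernel_def)
    have "u \<noteq> v"
    proof
      assume "u = v"
      have slack: "0 \<le> y c - (neg_part a c + neg_part b c)" if "c \<in> C" for c
      proof -
        have "neg_part v c \<le> y c"
          using u(2,3) step.IH that \<open>u = v\<close> by (auto simp: neg_part_def)
        then show ?thesis using v by simp
      qed
      \<comment> \<open>The slack is nonnegative, but its image is minus that of
        \<open>neg_part b\<close>, as \<open>y\<close> and \<open>neg_part a\<close> have the same
        image.\<close>
      have le: "mat_vec C A (neg_part b) r \<le> 0" if "r \<in> R" for r
      proof -
        have "0 \<le> mat_vec C A (\<lambda>c. y c - (neg_part a c + neg_part b c)) r"
          using slack by (auto simp: mat_vec_def intro!: sum_nonneg)
        also have "\<dots> = - mat_vec C A (neg_part b) r"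
          using step.IH that by (simp add: mat_vec_diff mat_vec_add)
        finally show ?thesis by simp
      qed
      have "neg_part b c = 0" "pos_part b c = 0" if "c \<in> C" for c
        using mat_vec_nonpos_imp_eq_0[OF C _ _ that, of "neg_part b"]
          mat_vec_nonpos_imp_eq_0[OF C _ _ that, of "pos_part b"]
          le mat_vec_pos_neg_part[OF b(1)] by (auto simp: neg_part_def pos_part_def)
      then have "b c = 0" for c
        using b(1) by (cases "c \<in> C")
          (fastforce simp: neg_part_def pos_part_def int_kernel_def vecs_def max_def split: if_splits)+
      then show False using b(2) by auto
    qed
    then have "(y, z) \<in> markov_steps C (M - {v})" using u by (auto simp: markov_steps_def)
    then show ?case using step.IH u(3) mz by (meson rtrancl.rtrancl_into_rtrancl)
  qed
  then show ?thesis by blast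
qed

text \<open>A proper conformal split of \<open>v\<close> would provide a detour for the move
  \<open>v\<close> through the other elements of \<open>M\<close>, so \<open>M - {v}\<close> would
  still be a Markov basis, against minimality.\<close>

lemma universal_markov_basis_indecomposable:
  assumes C: "finite C" "\<forall>c\<in>C. \<exists>r\<in>R. A r c > 0"
    and v: "v \<in> universal_markov_basis R C A"
    and a: "a \<in> int_kernel R C A" and conf: "conformal a v"
  shows "a = (\<lambda>_. 0) \<or> a = v"
proof (rule ccontr)
  assume neq: "\<not> ?thesis"
  obtain M where M: "minimal_markov_basis R C A M" "v \<in> M"
    using v by (auto simp: universal_markov_basis_def)
  have mb: "markov_basis R C A M" using M by (simp add: minimal_markov_basis_def)
  then have vK: "v \<in> int_kernel R C A" using M(2) by (auto simp: markov_basis_def)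
  define b where "b = (\<lambda>c. v c - a c)"
  have bK: "b \<in> int_kernel R C A"
    using a vK by (auto simp: b_def int_kernel_def mat_vec_diff vecs_def)
  have b0: "b \<noteq> (\<lambda>_. 0)" using neq by (metis b_def eq_iff_diff_eq_0 ext)
  have neg: "neg_part v c = neg_part a c + neg_part b c"
    and pos: "pos_part v c = pos_part a c + pos_part b c" for c
    using conf by (auto simp: conformal_def neg_part_def pos_part_def b_def max_def dest!: spec[of _ c])
  let ?S = "markov_steps C (M - {v})"
  have "(neg_part a, pos_part a) \<in> ?S\<^sup>*"
    by (rule nonneg_path_avoids_decomposable[OF C mb a bK b0 neg])
  \<comment> \<open>The detour has two legs: \<open>neg_part a\<close> is exchanged for
    \<open>pos_part a\<close> while \<open>neg_part b\<close> is carried along, then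
    \<open>neg_part b\<close> for \<open>pos_part b\<close> while \<open>pos_part a\<close> is
    carried along.\<close>
  then have 1: "((\<lambda>c. neg_part a c + neg_part b c), (\<lambda>c. pos_part a c + neg_part b c)) \<in> ?S\<^sup>*"
    by (rule markov_steps_rtrancl_shift) (simp add: neg_part_def)
  have "(neg_part b, pos_part b) \<in> ?S\<^sup>*"
    using neq neg by (intro nonneg_path_avoids_decomposable[OF C mb bK a]) auto
  then have "((\<lambda>c. neg_part b c + pos_part a c), (\<lambda>c. pos_part b c + pos_part a c)) \<in> ?S\<^sup>*"
    by (rule markov_steps_rtrancl_shift) (simp add: pos_part_def)
  then have 2: "((\<lambda>c. pos_part a c + neg_part b c), (\<lambda>c. pos_part a c + pos_part b c)) \<in> ?S\<^sup>*"
    by (simp add: add.commute)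
  from rtrancl_trans[OF 1 2] have vpath: "(neg_part v, pos_part v) \<in> ?S\<^sup>*"
    by (simp flip: neg pos)
  have "(x, y) \<in> ?S\<^sup>*" if "(x, y) \<in> (markov_steps C M)\<^sup>*" "\<forall>c\<in>C. 0 \<le> x c" for x y
  proof -
    from that(1) have "(\<forall>c\<in>C. 0 \<le> y c) \<and> (x, y) \<in> ?S\<^sup>*"
    proof (induction rule: rtrancl_induct)
      case base
      then show ?case using that(2) by simp
    next
      case (step y z)
      then obtain u where u: "u \<in> M" "z = (\<lambda>c. y c + u c)" "\<forall>c\<in>C. 0 \<le> z c"
        by (auto simp: markov_steps_def)
      have "(y, z) \<in> ?S\<^sup>*"
      proof (cases "u = v")
        case False
        then show ?thesis using u by (auto simp: markov_steps_def)
      next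
        case True
        \<comment> \<open>Both \<open>y\<close> and \<open>y + v\<close> are nonnegative, hence
          \<open>y\<close> lies above \<open>neg_part v\<close>, and the detour can be translated by
          the difference.\<close>
        have "\<forall>c\<in>C. 0 \<le> y c - neg_part v c"
          using step.IH u True by (auto simp: neg_part_def max_def)
        from markov_steps_rtrancl_shift[OF vpath this]
        have "((\<lambda>c. y c), (\<lambda>c. pos_part v c + (y c - neg_part v c))) \<in> ?S\<^sup>*" by simp
        moreover have "(\<lambda>c. pos_part v c + (y c - neg_part v c)) = z"
          using u(2) True by (auto simp: pos_part_def neg_part_def max_def)
        ultimately show ?thesis by simp
      qed
      then show ?case using step.IH u(3) by (meson rtrancl_trans)
    qed
    then show ?thesis by blast
  qed
  then have "markov_basis R C A (M - {v})"
    using mb unfolding markov_basis_iff by (intro conjI ballI impI) auto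
  moreover have "M - {v} \<subset> M" using M(2) by blast
  ultimately show False using M(1) by (auto simp: minimal_markov_basis_def)
qed

section \<open>Slices of tables\<close>

text \<open>\<open>U a\<close> is the slice at level \<open>a\<close> of the first index. The
  restriction makes the remaining indices extensional, as in \<open>cells {2..n} d\<close>.\<close>

definition table :: "nat \<Rightarrow> (nat \<Rightarrow> nat) \<Rightarrow> (nat \<Rightarrow> (nat \<Rightarrow> nat) \<Rightarrow> int) \<Rightarrow> (nat \<Rightarrow> nat) \<Rightarrow> int" where
  "table n d U = (\<lambda>i. if i \<in> cells {1..n} d then U (i 1) (restrict i {2..n}) else 0)"

text \<open>Removing 1 from \<open>F\<close> lets one definition serve both kinds of facets; those
  without 1 are unchanged by it.\<close>

definition slice_lattice :: "nat \<Rightarrow> (nat \<Rightarrow> nat) \<Rightarrow> nat set set \<Rightarrow> ((nat \<Rightarrow> nat) \<Rightarrow> int) set" where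
  "slice_lattice n d Fs = {w \<in> vecs (cells {2..n} d). \<forall>F\<in>Fs. \<forall>k\<in>cells (F - {1}) d.
     (\<Sum>y\<in>{y \<in> cells {2..n} d. restrict y (F - {1}) = k}. w y) = 0}"

lemma lattice_on_slice_lattice: "lattice_on (cells {2..n} d) (slice_lattice n d Fs)"
  by (auto simp: lattice_on_def slice_lattice_def vecs_def sum_subtractf)

lemma cells_upd_first: "1 \<notin> F \<Longrightarrow> cells F (d(1 := x)) = cells F d"
  unfolding cells_def by (rule PiE_cong) auto

text \<open>Only coordinates other than 1 enter the lattice, which is why the bound can be fixed
  before the size of the first index.\<close>

lemma slice_lattice_upd_first: "slice_lattice n (d(1 := x)) Fs = slice_lattice n d Fs"
proof -
  have "cells {2..n} (d(1 := x)) = cells {2..n} d" "cells (F - {1}) (d(1 := x)) = cells (F - {1}) d" for F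
    by (rule cells_upd_first; simp)+
  then show ?thesis by (simp only: slice_lattice_def)
qed

lemma fun_upd_in_cells:
  assumes "n \<ge> 1" "a \<in> {1..d 1}" "y \<in> cells {2..n} d"
  shows "y(1 := a) \<in> cells {1..n} d" "restrict (y(1 := a)) {2..n} = y"
proof -
  show "y(1 := a) \<in> cells {1..n} d"
    using assms by (auto simp: cells_def PiE_iff extensional_def)
  show "restrict (y(1 := a)) {2..n} = y"
    using assms by (auto simp: cells_def PiE_iff extensional_def restrict_def)
qed

lemma in_cells_decompose:
  assumes "n \<ge> 1" "i \<in> cells {1..n} d"
  shows "i 1 \<in> {1..d 1}" "restrict i {2..n} \<in> cells {2..n} d" "(restrict i {2..n})(1 := i 1) = i"
proof -
  show "i 1 \<in> {1..d 1}" using assms by (force simp: cells_def PiE_iff)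
  show "restrict i {2..n} \<in> cells {2..n} d" using assms by (force simp: cells_def PiE_iff)
  show "(restrict i {2..n})(1 := i 1) = i"
    using assms by (auto simp: cells_def PiE_iff extensional_def restrict_def fun_eq_iff)
qed

lemma table_apply:
  "n \<ge> 1 \<Longrightarrow> a \<in> {1..d 1} \<Longrightarrow> y \<in> cells {2..n} d \<Longrightarrow> table n d U (y(1 := a)) = U a y"
  using fun_upd_in_cells[of n a d y] by (simp add: table_def)

lemma table_of_slices:
  assumes "n \<ge> 1" "v \<in> vecs (cells {1..n} d)"
  shows "table n d (\<lambda>a y. if y \<in> cells {2..n} d then v (y(1 := a)) else 0) = v"
proof
  fix i
  show "table n d (\<lambda>a y. if y \<in> cells {2..n} d then v (y(1 := a)) else 0) i = v i"
  proof (cases "i \<in> cells {1..n} d")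
    case True
    then show ?thesis using in_cells_decompose[OF assms(1) True] by (simp only: table_def if_True)
  next
    case False
    then show ?thesis using assms(2) by (simp add: table_def vecs_def)
  qed
qed

lemma conformal_table:
  assumes "n \<ge> 1" "\<forall>a\<in>{1..d 1}. conformal (U' a) (U a)"
  shows "conformal (table n d U') (table n d U)"
  unfolding conformal_def table_def
  using assms(2) in_cells_decompose(1)[OF assms(1)] by (auto simp: conformal_def)

lemma sum_table:
  assumes "n \<ge> 1"
  shows "(\<Sum>i\<in>{i \<in> cells {1..n} d. P i}. table n d U i) =
    (\<Sum>a\<in>{1..d 1}. \<Sum>y\<in>{y \<in> cells {2..n} d. P (y(1 := a))}. U a y)"
proof -
  have "(\<Sum>a\<in>{1..d 1}. \<Sum>y\<in>{y \<in> cells {2..n} d. P (y(1 := a))}. U a y) =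
      (\<Sum>(a, y)\<in>(SIGMA a:{1..d 1}. {y \<in> cells {2..n} d. P (y(1 := a))}). U a y)"
    by (rule sum.Sigma) (auto simp: finite_cells)
  also have "\<dots> = (\<Sum>i\<in>{i \<in> cells {1..n} d. P i}. table n d U i)"
  proof (rule sum.reindex_bij_witness[of _ "\<lambda>i. (i 1, restrict i {2..n})" "\<lambda>(a, y). y(1 := a)"])
    fix z assume "z \<in> (SIGMA a:{1..d 1}. {y \<in> cells {2..n} d. P (y(1 := a))})"
    then obtain a y where z: "z = (a, y)" "a \<in> {1..d 1}" "y \<in> cells {2..n} d" "P (y(1 := a))"
      by blast
    note y = fun_upd_in_cells[OF assms z(2,3)]
    show "((case z of (a, y) \<Rightarrow> y(1 := a)) 1, restrict (case z of (a, y) \<Rightarrow> y(1 := a)) {2..n}) = z"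
      using y(2) by (simp add: z(1))
    show "(case z of (a, y) \<Rightarrow> y(1 := a)) \<in> {i \<in> cells {1..n} d. P i}"
      using y(1) z(4) by (simp add: z(1))
    show "table n d U (case z of (a, y) \<Rightarrow> y(1 := a)) = (case z of (a, y) \<Rightarrow> U a y)"
      using table_apply[OF assms z(2,3)] by (simp add: z(1))
  next
    fix i assume "i \<in> {i \<in> cells {1..n} d. P i}"
    then have i: "i \<in> cells {1..n} d" "P i" by auto
    note i' = in_cells_decompose[OF assms i(1)]
    show "(case (i 1, restrict i {2..n}) of (a, y) \<Rightarrow> y(1 := a)) = i"
      using i'(3) by simp
    show "(i 1, restrict i {2..n}) \<in> (SIGMA a:{1..d 1}. {y \<in> cells {2..n} d. P (y(1 := a))})"
      using i'(1,2) i(2) i'(3) by simp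
  qed
  finally show ?thesis by simp
qed

text \<open>Prescribing the coordinates in \<open>F\<close> fixes the first index as well, so a
  single slice contributes.\<close>

lemma marginal_map_table_facet_with_first:
  assumes n: "n \<ge> 1" and F: "1 \<in> F" and k: "k \<in> cells F d"
  shows "marginal_map n d (table n d U) (F, k) =
    (\<Sum>y\<in>{y \<in> cells {2..n} d. restrict y (F - {1}) = restrict k (F - {1})}. U (k 1) y)"
proof -
  have k1: "k 1 \<in> {1..d 1}" using k F by (force simp: cells_def PiE_iff)
  have eq: "restrict (y(1 := a)) F = k \<longleftrightarrow>
      k 1 = a \<and> restrict y (F - {1}) = restrict k (F - {1})" for y a
  proof
    assume "restrict (y(1 := a)) F = k"
    then show "k 1 = a \<and> restrict y (F - {1}) = restrict k (F - {1})"
      using F by (auto simp: restrict_def)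
  next
    assume r: "k 1 = a \<and> restrict y (F - {1}) = restrict k (F - {1})"
    show "restrict (y(1 := a)) F = k"
    proof
      fix j
      consider "j = 1" | "j \<in> F - {1}" | "j \<notin> F" by blast
      then show "restrict (y(1 := a)) F j = k j"
      proof cases
        case 1
        then show ?thesis using r F by simp
      next
        case 2
        then show ?thesis using fun_cong[OF conjunct2[OF r], of j] by simp
      next
        case 3
        then show ?thesis using k by (auto simp: cells_def PiE_iff extensional_def)
      qed
    qed
  qed
  have "marginal_map n d (table n d U) (F, k) =
      (\<Sum>a\<in>{1..d 1}. \<Sum>y\<in>{y \<in> cells {2..n} d. restrict (y(1 := a)) F = k}. U a y)"
    unfolding marginal_map_def prod.case by (rule sum_table[OF n])
  also have "\<dots> = (\<Sum>a\<in>{1..d 1}. if k 1 = a then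
      (\<Sum>y\<in>{y \<in> cells {2..n} d. restrict y (F - {1}) = restrict k (F - {1})}. U (k 1) y) else 0)"
    unfolding eq by (intro sum.cong) auto
  also have "\<dots> = (\<Sum>y\<in>{y \<in> cells {2..n} d. restrict y (F - {1}) = restrict k (F - {1})}. U (k 1) y)"
    using k1 by simp
  finally show ?thesis .
qed

text \<open>The first index is unconstrained, so the margin sees the slices only through their
  sum.\<close>

lemma marginal_map_table_facet_without_first:
  assumes n: "n \<ge> 1" and F: "1 \<notin> F"
  shows "marginal_map n d (table n d U) (F, k) =
    (\<Sum>y\<in>{y \<in> cells {2..n} d. restrict y (F - {1}) = k}. \<Sum>a\<in>{1..d 1}. U a y)"
proof -
  have eq: "restrict (y(1 := a)) F = restrict y (F - {1})" for y :: "nat \<Rightarrow> nat" and a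
    using F by (auto simp: restrict_def fun_eq_iff)
  have "marginal_map n d (table n d U) (F, k) =
      (\<Sum>a\<in>{1..d 1}. \<Sum>y\<in>{y \<in> cells {2..n} d. restrict (y(1 := a)) F = k}. U a y)"
    unfolding marginal_map_def prod.case by (rule sum_table[OF n])
  then show ?thesis unfolding eq by (subst (asm) sum.swap)
qed

text \<open>Facets containing 1 constrain each slice separately, the others constrain only the sum
  of the slices. This translates the kernel into the setting of
  \<open>bounded_conformal_complexity\<close>.\<close>

lemma table_in_kernel_iff:
  assumes n: "n \<ge> 1"
    and U: "\<forall>a\<in>{1..d 1}. U a \<in> vecs (cells {2..n} d)"
  shows "table n d U \<in> int_kernel (margin_index \<Delta> d) (cells {1..n} d) (model_matrix n d) \<longleftrightarrow>
    (\<forall>a\<in>{1..d 1}. U a \<in> slice_lattice n d {F \<in> facets \<Delta>. 1 \<in> F}) \<and>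
    (\<lambda>y. \<Sum>a\<in>{1..d 1}. U a y) \<in> slice_lattice n d {F \<in> facets \<Delta>. 1 \<notin> F}"
proof -
  let ?m = "marginal_map n d (table n d U)"
  have vecs: "table n d U \<in> vecs (cells {1..n} d)" "(\<lambda>y. \<Sum>a\<in>{1..d 1}. U a y) \<in> vecs (cells {2..n} d)"
    using U by (auto simp: vecs_def table_def intro!: sum.neutral)
  have "table n d U \<in> int_kernel (margin_index \<Delta> d) (cells {1..n} d) (model_matrix n d) \<longleftrightarrow>
      (\<forall>F\<in>facets \<Delta>. \<forall>k\<in>cells F d. ?m (F, k) = 0)"
    using vecs by (auto simp: int_kernel_def margin_index_def mat_vec_model_matrix simp del: One_nat_def)
  also have "\<dots> \<longleftrightarrow> (\<forall>F\<in>{F \<in> facets \<Delta>. 1 \<in> F}. \<forall>k\<in>cells F d. ?m (F, k) = 0) \<and>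
      (\<forall>F\<in>{F \<in> facets \<Delta>. 1 \<notin> F}. \<forall>k\<in>cells F d. ?m (F, k) = 0)"
    by blast
  also have "(\<forall>F\<in>{F \<in> facets \<Delta>. 1 \<notin> F}. \<forall>k\<in>cells F d. ?m (F, k) = 0) \<longleftrightarrow>
      (\<lambda>y. \<Sum>a\<in>{1..d 1}. U a y) \<in> slice_lattice n d {F \<in> facets \<Delta>. 1 \<notin> F}"
    using vecs by (auto simp: slice_lattice_def marginal_map_table_facet_without_first[OF n] simp del: One_nat_def)
  also have "(\<forall>F\<in>{F \<in> facets \<Delta>. 1 \<in> F}. \<forall>k\<in>cells F d. ?m (F, k) = 0) \<longleftrightarrow>
      (\<forall>a\<in>{1..d 1}. U a \<in> slice_lattice n d {F \<in> facets \<Delta>. 1 \<in> F})"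
  proof -
    have "(\<forall>k\<in>cells F d. ?m (F, k) = 0) \<longleftrightarrow> (\<forall>a\<in>{1..d 1}. \<forall>k\<in>cells (F - {1}) d.
        (\<Sum>y\<in>{y \<in> cells {2..n} d. restrict y (F - {1}) = k}. U a y) = 0)" if F: "1 \<in> F" for F
    proof (intro iffI ballI)
      fix a k assume *: "\<forall>k\<in>cells F d. ?m (F, k) = 0" and a: "a \<in> {1..d 1}" and k: "k \<in> cells (F - {1}) d"
      \<comment> \<open>Completing \<open>k\<close> by the level \<open>a\<close> gives the margin
        entry that expresses the condition on slice \<open>a\<close>.\<close>
      have k': "k(1 := a) \<in> cells F d" "restrict (k(1 := a)) (F - {1}) = k"
        using a k F by (auto simp: cells_def PiE_iff extensional_def restrict_def fun_eq_iff)
      show "(\<Sum>y\<in>{y \<in> cells {2..n} d. restrict y (F - {1}) = k}. U a y) = 0"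
        using marginal_map_table_facet_with_first[OF n F k'(1), of U] * k' by simp
    next
      fix k assume *: "\<forall>a\<in>{1..d 1}. \<forall>k\<in>cells (F - {1}) d.
        (\<Sum>y\<in>{y \<in> cells {2..n} d. restrict y (F - {1}) = k}. U a y) = 0" and k: "k \<in> cells F d"
      have "k 1 \<in> {1..d 1}" "restrict k (F - {1}) \<in> cells (F - {1}) d"
        using k F by (force simp: cells_def PiE_iff)+
      then show "?m (F, k) = 0"
        using * by (simp only: marginal_map_table_facet_with_first[OF n F k])
    qed
    then show ?thesis using U by (auto simp: slice_lattice_def)
  qed
  finally show ?thesis .
qed

section \<open>Absence of zero columns and the uniform bound\<close>

lemma facets_nonempty:
  assumes "simplicial_complex_on V \<Delta>" "finite V"
  shows "facets \<Delta> \<noteq> {}"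
proof -
  have "finite \<Delta>" "\<Delta> \<noteq> {}"
    using assms by (auto simp: simplicial_complex_on_def intro: finite_subset)
  then obtain F where "F \<in> \<Delta>" "\<forall>G\<in>\<Delta>. F \<subseteq> G \<longrightarrow> F = G"
    using finite_has_maximal[of \<Delta>] by blast
  then show ?thesis by (auto simp: facets_def)
qed

text \<open>Each cell is counted in its own entry of the margin of any facet, and a facet exists
  because the complex is not void.\<close>

lemma model_matrix_column_nonzero:
  assumes "simplicial_complex_on {1..n} \<Delta>" "c \<in> cells {1..n} d"
  shows "\<exists>r\<in>margin_index \<Delta> d. model_matrix n d r c > 0"
proof -
  obtain F where F: "F \<in> facets \<Delta>" using facets_nonempty[OF assms(1)] by auto
  then have "F \<subseteq> {1..n}" using assms(1) by (auto simp: facets_def simplicial_complex_on_def)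
  then have "(F, restrict c F) \<in> margin_index \<Delta> d"
    using F assms(2) by (auto simp: margin_index_def cells_def PiE_iff)
  then show ?thesis using model_matrix_entry[OF assms(2), of F "restrict c F"] by force
qed

theorem theorem1p1:
  fixes n :: nat and \<Delta> :: "nat set set" and d :: "nat \<Rightarrow> nat"
  assumes "n \<ge> 1"
    and "simplicial_complex_on {1..n} \<Delta>"
    and "\<And>j. j \<in> {2..n} \<Longrightarrow> d j \<ge> 2"
  shows "\<exists>m::nat. \<forall>d1::nat. d1 \<ge> m \<longrightarrow> d1 \<ge> 2 \<longrightarrow>
           (\<forall>v \<in> hierarchical_umb n \<Delta> (d(1 := d1)). card (nonzero_slices n (d(1 := d1)) v) \<le> m)"
proof -
  \<comment> \<open>Keeps the index 1 from being rewritten to \<open>Suc 0\<close>, so that the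
    slice lemmas still match.\<close>
  note One_nat_def[simp del]
  let ?J = "cells {2..n} d"
  let ?K = "slice_lattice n d {F \<in> facets \<Delta>. 1 \<in> F}"
  let ?L = "slice_lattice n d {F \<in> facets \<Delta>. 1 \<notin> F}"
  \<comment> \<open>Both lattices are free of \<open>d 1\<close>, so \<open>m\<close> is chosen
    before \<open>d1\<close>, and index sets \<open>{1..d1}\<close> of every size are
    covered.\<close>
  obtain m :: nat where m: "\<And>(I :: nat set) w. finite I \<Longrightarrow> (\<And>i. i \<in> I \<Longrightarrow> w i \<in> ?K) \<Longrightarrow>
      (\<lambda>y. \<Sum>i\<in>I. w i y) \<in> ?L \<Longrightarrow> m < card {i \<in> I. w i \<noteq> (\<lambda>_. 0)} \<Longrightarrow> splittable ?K ?L I w"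
    by (rule bounded_conformal_complexity[OF finite_cells[of "{2..n}" d]
          lattice_on_slice_lattice lattice_on_slice_lattice]) auto
  show ?thesis
  proof (intro exI[of _ m] allI impI ballI, rule ccontr)
    fix d1 v
    define e where "e = d(1 := d1)"
    assume "v \<in> hierarchical_umb n \<Delta> (d(1 := d1))"
      and "\<not> card (nonzero_slices n (d(1 := d1)) v) \<le> m"
    then have v: "v \<in> universal_markov_basis (margin_index \<Delta> e) (cells {1..n} e) (model_matrix n e)"
      and many: "card (nonzero_slices n e v) > m"
      by (simp_all add: hierarchical_umb_def e_def)
    let ?ker = "int_kernel (margin_index \<Delta> e) (cells {1..n} e) (model_matrix n e)"
    have vK: "v \<in> ?ker"
      using v by (auto simp: universal_markov_basis_def minimal_markov_basis_def markov_basis_def)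
    have J: "cells {2..n} e = ?J" unfolding e_def by (rule cells_upd_first) simp
    have lat: "slice_lattice n e Fs = slice_lattice n d Fs" for Fs
      unfolding e_def by (rule slice_lattice_upd_first)
    \<comment> \<open>The default 0 outside \<open>?J\<close> makes each slice a vector supported on
      \<open>?J\<close>, so slices are comparable as functions.\<close>
    define w where "w = (\<lambda>a y. if y \<in> ?J then v (y(1 := a)) else 0)"
    have vw: "table n e w = v"
      using table_of_slices[OF assms(1), of v e] vK by (simp add: w_def J int_kernel_def)
    have wJ: "w a \<in> vecs ?J" for a by (simp add: w_def vecs_def)
    have w: "\<forall>a\<in>{1..e 1}. w a \<in> ?K" "(\<lambda>y. \<Sum>a\<in>{1..e 1}. w a y) \<in> ?L"
      using table_in_kernel_iff[OF assms(1), of e w \<Delta>] vK wJ by (simp_all add: vw J lat)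
    have "nonzero_slices n e v \<subseteq> {a \<in> {1..e 1}. w a \<noteq> (\<lambda>_. 0)}"
    proof
      fix a assume "a \<in> nonzero_slices n e v"
      then obtain i where i: "a \<in> {1..e 1}" "i \<in> cells {1..n} e" "i 1 = a" "v i \<noteq> 0"
        by (auto simp: nonzero_slices_def)
      then have "w a (restrict i {2..n}) \<noteq> 0"
        using vw by (auto simp: table_def)
      then show "a \<in> {a \<in> {1..e 1}. w a \<noteq> (\<lambda>_. 0)}" using i(1) by auto
    qed
    then have "card {a \<in> {1..e 1}. w a \<noteq> (\<lambda>_. 0)} > m"
      using many card_mono[of "{a \<in> {1..e 1}. w a \<noteq> (\<lambda>_. 0)}" "nonzero_slices n e v"] by simp
    then have "splittable ?K ?L {1..e 1} w"
      using w by (intro m) auto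
    then obtain w' where w': "\<forall>a\<in>{1..e 1}. w' a \<in> ?K \<and> conformal (w' a) (w a)"
      "(\<lambda>y. \<Sum>a\<in>{1..e 1}. w' a y) \<in> ?L"
      "\<exists>a\<in>{1..e 1}. w' a \<noteq> (\<lambda>_. 0)" "\<exists>a\<in>{1..e 1}. w' a \<noteq> w a"
      unfolding splittable_def by blast
    have w'J: "\<forall>a\<in>{1..e 1}. w' a \<in> vecs ?J" using w'(1) by (auto simp: slice_lattice_def)
    have "table n e w' \<in> ?ker"
      using table_in_kernel_iff[OF assms(1), of e w' \<Delta>] w' w'J by (simp add: J lat)
    moreover have "conformal (table n e w') v"
      using conformal_table[OF assms(1), of e w' w] w'(1) by (simp add: vw)
    ultimately have triv: "table n e w' = (\<lambda>_. 0) \<or> table n e w' = v"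
      using universal_markov_basis_indecomposable[OF _ _ v]
        model_matrix_column_nonzero[OF assms(2)] by (simp add: finite_cells)
    \<comment> \<open>Families supported on \<open>?J\<close> that differ at a level in range give
      different tables. Comparison with the zero family and with \<open>w\<close> shows that the
      split table is neither 0 nor \<open>v\<close>.\<close>
    have differ: "table n e w' \<noteq> table n e u"
      if a: "a \<in> {1..e 1}" and neq: "w' a \<noteq> u a" and u: "u a \<in> vecs ?J" for a u
    proof -
      obtain y where y: "w' a y \<noteq> u a y" using neq by blast
      have "y \<in> ?J"
      proof (rule ccontr)
        assume "y \<notin> ?J"
        then have "w' a y = 0" "u a y = 0" using w'J a u by (auto simp: vecs_def)
        then show False using y by simp
      qed
      then have "table n e w' (y(1 := a)) \<noteq> table n e u (y(1 := a))"
        using y a assms(1) by (simp add: table_apply J)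
      then show ?thesis by metis
    qed
    have "table n e (\<lambda>_ _. 0) = (\<lambda>_. 0)" by (simp add: table_def fun_eq_iff)
    moreover have "(\<lambda>_. 0) \<in> vecs ?J" by (simp add: vecs_def)
    ultimately have "table n e w' \<noteq> (\<lambda>_. 0)"
      using w'(3) differ[of _ "\<lambda>_ _. 0"] by metis
    moreover have "table n e w' \<noteq> v" using w'(4) differ[of _ w] wJ by (metis vw)
    ultimately show False using triv by blast
  qed
qed

end
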